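(* Let $x^{+}=A(x)x+B(x)u$ be the system described in the context, let $r>0$ be such that $\mathcal{B}_r\subseteq\mathbb{X}$, and let $\bar{\mathcal{G}}$ be the finite vertex set defined in the context. Suppose there exist a symmetric matrix $\Gamma\in\mathbb{R}^{n\times n}$ with $\Gamma\succ 0$, a real number $\epsilon_\Gamma>0$ and a matrix $Y\in\mathbb{R}^{m\times n}$ such that $$\begin{bmatrix} -\Gamma & G\begin{bmatrix}\Gamma\\ Y\end{bmatrix}\\ [\Gamma\ \ Y^\top]G^\top & -\Gamma+\epsilon_\Gamma I_n\end{bmatrix}\preceq 0\qquad\text{for all } G\in\bar{\mathcal{G}} .$$ Let $K=Y\Gamma^{-1}$ and $u=Kx$. Then $\mathcal{B}_{r_0}$, with $$r_0=\min\left\{r,\ \sqrt{\frac{\lambda_{\max}(\Gamma)\lambda_{\min}(\Gamma)}{\lambda_{\max}^2(\Gamma)-\epsilon_\Gamma\lambda_{\min}(\Gamma)}}\cdot r\right\}$$ (the quotient being read as $+\infty$ if its denominator is $0$), is a region of attraction of the closed-loop system $x^{+}=(A(x)+B(x)K)x$ relative to the equilibrium $0$, and the closed-loop system starting from any $x(0)\in\mathcal{B}_{r_0}$ exponentially converges to the origin.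
   Context: System: $n,m\ge1$; $\mathbb{X}\subseteq\mathbb{R}^n$ contains the origin; $A(x)=[a_{ij}(x)]_{n\times n}$ and $B(x)=[b_{ij}(x)]_{n\times m}$ with entries $a_{ij},b_{ij}:\mathbb{X}\to\mathbb{R}$ continuous. The discrete-time system is $x^{+}=A(x)x+B(x)u$ with state $x\in\mathbb{R}^n$, input $u\in\mathbb{R}^m$, and $x^{+}(k)=x(k+1)$, $k\in\mathbb{N}=\{0,1,2,\dots\}$. Notation: $|\cdot|$ is the Euclidean norm; $\mathcal{B}_r=\{x\in\mathbb{R}^n:|x|\le r\}$; $\lambda_{\max},\lambda_{\min}$ are the largest and smallest eigenvalues of a symmetric matrix; $\succ,\succeq,\preceq$ denote the Loewner order. Vertex set: with $\bar a_{ij}=\max_{x\in\mathcal{B}_r}a_{ij}(x)$, $\underline a_{ij}=\min_{x\in\mathcal{B}_r}a_{ij}(x)$, $\bar b_{ij}=\max_{x\in\mathcal{B}_r}b_{ij}(x)$, $\underline b_{ij}=\min_{x\in\mathcal{B}_r}b_{ij}(x)$, $$\bar{\mathcal{G}}=\Big\{\big[[\alpha_{ij}]_{n\times n}\ \ [\beta_{ij}]_{n\times m}\big]\in\mathbb{R}^{n\times(n+m)}:\alpha_{ij}\in\{\bar a_{ij},\underline a_{ij}\},\ \beta_{ij}\in\{\bar b_{ij},\underline b_{ij}\}\Big\}.$$ A set $\mathcal{R}\subset\mathbb{R}^n$ is a region of attraction of $x^{+}=f(x)$ relative to the equilibrium $0$ if for every $x(0)\in\mathcal{R}$ the solution satisfies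 $\lim_{k\to\infty}x(k)=0$. Exponential convergence to the origin from a set $\mathcal{R}$ means there are constants $c>0$, $\rho\in(0,1)$ such that $|x(k)|\le c\rho^k|x(0)|$ for all $k\in\mathbb{N}$ and all $x(0)\in\mathcal{R}$. These claims include that the solution remains in $\mathbb{X}$, so that it is defined for all $k$. *)

theory Defs
  imports "HOL-Analysis.Analysis"
begin

definition hcat :: "real^'a^'c \<Rightarrow> real^'b^'c \<Rightarrow> real^('a + 'b)^'c" where
  "hcat M N = (\<chi> i j. case j of Inl a \<Rightarrow> M $ i $ a | Inr b \<Rightarrow> N $ i $ b)"

definition vcat :: "real^'c^'a \<Rightarrow> real^'c^'b \<Rightarrow> real^'c^('a + 'b)" where
  "vcat M N = (\<chi> i. case i of Inl a \<Rightarrow> M $ a | Inr b \<Rightarrow> N $ b)"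

definition block22 ::
  "real^'a^'c \<Rightarrow> real^'b^'c \<Rightarrow> real^'a^'d \<Rightarrow> real^'b^'d \<Rightarrow> real^('a + 'b)^('c + 'd)" where
  "block22 M N P Q = vcat (hcat M N) (hcat P Q)"

definition symmetric_matrix :: "real^'n^'n \<Rightarrow> bool" where
  "symmetric_matrix M \<longleftrightarrow> transpose M = M"

definition pos_semidef :: "real^'n^'n \<Rightarrow> bool" where
  "pos_semidef M \<longleftrightarrow> symmetric_matrix M \<and> (\<forall>v. 0 \<le> v \<bullet> (M *v v))"

definition pos_def :: "real^'n^'n \<Rightarrow> bool" where
  "pos_def M \<longleftrightarrow> symmetric_matrix M \<and> (\<forall>v. v \<noteq> 0 \<longrightarrow> 0 < v \<bullet> (M *v v))"

definition loewner_le :: "real^'n^'n \<Rightarrow> real^'n^'n \<Rightarrow> bool" (infix \<open>\<preceq>\<close> 50) where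
  "M \<preceq> N \<longleftrightarrow> pos_semidef (N - M)"

definition loewner_less :: "real^'n^'n \<Rightarrow> real^'n^'n \<Rightarrow> bool" (infix \<open>\<prec>\<close> 50) where
  "M \<prec> N \<longleftrightarrow> pos_def (N - M)"

definition eigenvalue :: "real^'n^'n \<Rightarrow> real \<Rightarrow> bool" where
  "eigenvalue M l \<longleftrightarrow> (\<exists>v. v \<noteq> 0 \<and> M *v v = l *\<^sub>R v)"

(* Meaningful for symmetric M, where real eigenvalues exist. *)
definition lambda_max :: "real^'n^'n \<Rightarrow> real" where
  "lambda_max M = (GREATEST l. eigenvalue M l)"

definition lambda_min :: "real^'n^'n \<Rightarrow> real" where
  "lambda_min M = (LEAST l. eigenvalue M l)"

(* Maximum and minimum of f over a possibly infinite set S; meaningful only when they are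
   attained, as for f continuous on a nonempty compact S. *)
definition max_on :: "'a set \<Rightarrow> ('a \<Rightarrow> real) \<Rightarrow> real" where
  "max_on S f = (GREATEST y. y \<in> f ` S)"

definition min_on :: "'a set \<Rightarrow> ('a \<Rightarrow> real) \<Rightarrow> real" where
  "min_on S f = (LEAST y. y \<in> f ` S)"

definition vertex_set ::
  "real \<Rightarrow> (real^'n \<Rightarrow> real^'n^'n) \<Rightarrow> (real^'n \<Rightarrow> real^'m^'n) \<Rightarrow> (real^('n + 'm)^'n) set" where
  "vertex_set r A B =
     {hcat \<alpha> \<beta> | \<alpha> \<beta>.
        (\<forall>i j. \<alpha> $ i $ j \<in> {max_on (cball 0 r) (\<lambda>x. A x $ i $ j),
                                min_on (cball 0 r) (\<lambda>x. A x $ i $ j)}) \<and>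
        (\<forall>i j. \<beta> $ i $ j \<in> {max_on (cball 0 r) (\<lambda>x. B x $ i $ j),
                                min_on (cball 0 r) (\<lambda>x. B x $ i $ j)})}"

(* The system x(k+1) = f (x k) lives on the set X; values of f outside X have no meaning.
   Hence each notion below requires the iterates to stay in X. *)
definition region_of_attraction ::
  "(real^'n) set \<Rightarrow> (real^'n \<Rightarrow> real^'n) \<Rightarrow> (real^'n) set \<Rightarrow> bool" where
  "region_of_attraction X f R \<longleftrightarrow>
     0 \<in> X \<and> f 0 = 0 \<and>
     (\<forall>x0\<in>R. (\<forall>k. (f ^^ k) x0 \<in> X) \<and> (\<lambda>k. (f ^^ k) x0) \<longlonglongrightarrow> 0)"

definition exponentially_convergent_from ::
  "(real^'n) set \<Rightarrow> (real^'n \<Rightarrow> real^'n) \<Rightarrow> (real^'n) set \<Rightarrow> bool" where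
  "exponentially_convergent_from X f R \<longleftrightarrow>
     (\<forall>x0\<in>R. \<forall>k. (f ^^ k) x0 \<in> X) \<and>
     (\<exists>c \<rho>. 0 < c \<and> 0 < \<rho> \<and> \<rho> < 1 \<and>
        (\<forall>x0\<in>R. \<forall>k. norm ((f ^^ k) x0) \<le> c * \<rho> ^ k * norm x0))"

end

theory Submission
  imports Defs
begin

text \<open>
  Put $V(x) = x^T \Gamma^{-1} x$. Since $p^T [A, B] w$ is linear in every entry of $[A, B]$, it is
  dominated over a box by its value at a vertex chosen according to the signs of $p_i w_j$; hence the
  matrix inequality, which is assumed at the vertices, holds along the closed loop at each
  $x \in \mathcal{B}_r$. Testing it with $p = \Gamma^{-1} x^+$ and $q = \Gamma^{-1} x$ gives
  $V(x^+) \le V(x) - \epsilon |\Gamma^{-1} x|^2$. Together with the Rayleigh bounds this is a contraction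
  of $V$ by the factor $1 - \epsilon \lambda_{\min} / \lambda_{\max}^2$; the same estimate in the first
  step puts $x(1)$ into the sublevel set $V \le r^2 / \lambda_{\max}$, which lies in $\mathcal{B}_r$
  and is never left again.
\<close>

section \<open>Block vectors and block matrices\<close>

lemma inner_sum_index:
  fixes x y :: "real^('a::finite + 'b::finite)"
  shows "x \<bullet> y = (\<chi> i. x $ Inl i) \<bullet> (\<chi> i. y $ Inl i) + (\<chi> i. x $ Inr i) \<bullet> (\<chi> i. y $ Inr i)"
  unfolding inner_vec_def UNIV_Plus_UNIV[symmetric]
  by (subst sum.Plus) auto

text \<open>Vector counterpart of \<open>vcat\<close>. Block matrices are tested only on vectors of
  this form, so that their quadratic forms split into one term per block.\<close>

definition vjoin :: "real^'a \<Rightarrow> real^'b \<Rightarrow> real^('a + 'b)" where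
  "vjoin p q = (\<chi> i. case i of Inl a \<Rightarrow> p $ a | Inr b \<Rightarrow> q $ b)"

lemma inner_vjoin: "vjoin p q \<bullet> vjoin p' q' = p \<bullet> p' + q \<bullet> q'"
  by (simp add: inner_sum_index vjoin_def)

lemma vcat_mult_vec: "vcat M N *v x = vjoin (M *v x) (N *v x)"
  by (simp add: vec_eq_iff vcat_def vjoin_def matrix_vector_mult_def split: sum.split)

lemma hcat_mult_vjoin: "hcat M N *v vjoin p q = M *v p + N *v q"
proof -
  have rows: "hcat M N $ i = vjoin (M $ i) (N $ i)" for i
    by (simp add: vec_eq_iff hcat_def vjoin_def split: sum.split)
  show ?thesis
    by (simp add: vec_eq_iff matrix_mult_dot rows inner_vjoin)
qed

lemma block22_quadratic_form:
  "vjoin p q \<bullet> (block22 M N P Q *v vjoin p q)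
    = p \<bullet> (M *v p) + p \<bullet> (N *v q) + (q \<bullet> (P *v p) + q \<bullet> (Q *v q))"
  by (simp add: block22_def vcat_mult_vec hcat_mult_vjoin inner_vjoin inner_add_right)

section \<open>Symmetric matrices: extreme eigenvalues and Rayleigh bounds\<close>

lemma uminus_matrix_mult_vec: "- M *v v = - (M *v v)" for M :: "real^'a^'b"
  by (simp add: vec_eq_iff matrix_vector_mult_def sum_negf)

lemma symmetric_matrix_inner:
  assumes "symmetric_matrix M"
  shows "x \<bullet> (M *v y) = y \<bullet> (M *v x)"
  using assms dot_lmul_matrix[of x M y] vector_transpose_matrix[of x M]
  by (simp add: symmetric_matrix_def inner_commute)

text \<open>If w = N v were nonzero, the form at v + t w, which equals t (2 |w|^2 + t w.(N w)),
  would be negative for small t < 0. This turns an extremal vector of a Rayleigh quotient into an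
  eigenvector.\<close>

lemma pos_semidef_null_vector:
  assumes "pos_semidef N" "v \<bullet> (N *v v) = 0"
  shows "N *v v = 0"
proof -
  define w where "w = N *v v"
  have sym: "v \<bullet> (N *v w) = w \<bullet> w"
    using symmetric_matrix_inner[of N v w] assms(1) by (simp add: pos_semidef_def w_def)
  have q: "0 \<le> t * (2 * (w \<bullet> w) + t * (w \<bullet> (N *v w)))" for t
  proof -
    have "0 \<le> (v + t *\<^sub>R w) \<bullet> (N *v (v + t *\<^sub>R w))"
      using assms(1) by (simp add: pos_semidef_def)
    also have "\<dots> = t * (2 * (w \<bullet> w) + t * (w \<bullet> (N *v w)))"
      using sym assms(2)
      by (simp add: matrix_vector_right_distrib matrix_vector_mult_scaleR inner_add_left
          inner_add_right algebra_simps flip: w_def)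
    finally show ?thesis .
  qed
  define a b where "a = w \<bullet> w" and "b = w \<bullet> (N *v w)"
  have "0 \<le> a" "0 \<le> b" using assms(1) by (simp_all add: a_def b_def pos_semidef_def)
  have "a \<le> 0"
  proof (rule ccontr)
    assume "\<not> a \<le> 0"
    \<comment> \<open>The test value is t = -a / (b + 1): it is small enough that 2 a + t b is at
      least a, and the summand 1 keeps the denominator positive when b = 0.\<close>
    have "a / (b + 1) * b \<le> a"
      using \<open>0 \<le> a\<close> \<open>0 \<le> b\<close> by (simp add: field_simps)
    moreover have "- (a / (b + 1)) < 0" using \<open>\<not> a \<le> 0\<close> \<open>0 \<le> b\<close> by simp
    ultimately have "- (a / (b + 1)) * (2 * a + - (a / (b + 1)) * b) < 0"
      using \<open>\<not> a \<le> 0\<close> by (intro mult_neg_pos) auto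
    then show False using q[of "- (a / (b + 1))"] by (simp add: a_def b_def)
  qed
  then have "a = 0" using \<open>0 \<le> a\<close> by linarith
  then show ?thesis unfolding a_def w_def inner_eq_zero_iff .
qed

text \<open>By compactness the form attains a maximum l on the unit sphere, at some v. Then l I - M
  is positive semidefinite and its form vanishes at v, so v is an eigenvector. No diagonalisation is
  involved.\<close>

lemma symmetric_matrix_max_eigenvalue:
  fixes M :: "real^'n^'n"
  assumes "symmetric_matrix M"
  obtains l where "eigenvalue M l" "\<And>x. x \<bullet> (M *v x) \<le> l * (x \<bullet> x)"
proof -
  have "sphere (0 :: real^'n) 1 \<noteq> {}" by simp
  then obtain v :: "real^'n" where v: "norm v = 1"
    and max: "\<And>x. norm x = 1 \<Longrightarrow> x \<bullet> (M *v x) \<le> v \<bullet> (M *v v)"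
    using continuous_attains_sup[of "sphere (0 :: real^'n) 1" "\<lambda>x. x \<bullet> (M *v x)"]
    by (force intro!: continuous_intros matrix_vector_mult_linear_continuous_on)
  define l where "l = v \<bullet> (M *v v)"
  have le: "x \<bullet> (M *v x) \<le> l * (x \<bullet> x)" for x
  proof (cases "x = 0")
    case False
    have "(x /\<^sub>R norm x) \<bullet> (M *v (x /\<^sub>R norm x)) \<le> l"
      using False unfolding l_def by (intro max) simp
    then have "x \<bullet> (M *v x) / (norm x)\<^sup>2 \<le> l"
      by (simp add: matrix_vector_mult_scaleR power2_eq_square field_simps)
    then show ?thesis using False by (simp add: power2_norm_eq_inner pos_divide_le_eq)
  qed simp
  have mult: "(l *\<^sub>R mat 1 - M) *v x = l *\<^sub>R x - M *v x" for x
    by (simp add: matrix_vector_mult_diff_rdistrib scaleR_matrix_vector_assoc[symmetric])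
  have "symmetric_matrix (l *\<^sub>R mat 1 - M)"
    using assms by (simp add: symmetric_matrix_def transpose_def vec_eq_iff mat_def)
  then have "pos_semidef (l *\<^sub>R mat 1 - M)"
    using le by (simp add: pos_semidef_def mult inner_diff_right)
  moreover have "v \<bullet> ((l *\<^sub>R mat 1 - M) *v v) = 0"
    using v by (simp add: mult inner_diff_right flip: l_def power2_norm_eq_inner)
  ultimately have "l *\<^sub>R v - M *v v = 0"
    using pos_semidef_null_vector mult by metis
  moreover have "v \<noteq> 0" using v by auto
  ultimately have "eigenvalue M l" by (auto simp: eigenvalue_def intro!: exI[of _ v])
  with le show thesis using that by blast
qed

lemma eigenvalue_rayleigh:
  assumes "eigenvalue M l"
  obtains v where "0 < v \<bullet> v" "v \<bullet> (M *v v) = l * (v \<bullet> v)"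
  using assms by (auto simp: eigenvalue_def)

text \<open>Every eigenvalue is the Rayleigh quotient of its eigenvector, so an eigenvalue that
  bounds all Rayleigh quotients is the one selected by \<open>GREATEST\<close>.\<close>

lemma rayleigh_le_lambda_max:
  assumes "symmetric_matrix M"
  shows "x \<bullet> (M *v x) \<le> lambda_max M * (x \<bullet> x)"
proof -
  obtain l where l: "eigenvalue M l" "\<And>x. x \<bullet> (M *v x) \<le> l * (x \<bullet> x)"
    using symmetric_matrix_max_eigenvalue[OF assms] by blast
  have "k \<le> l" if "eigenvalue M k" for k
    using that
  proof (rule eigenvalue_rayleigh)
    fix v assume "0 < v \<bullet> v" "v \<bullet> (M *v v) = k * (v \<bullet> v)"
    then show ?thesis using l(2)[of v] by (simp add: mult_le_cancel_right_pos)
  qed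
  with l have "lambda_max M = l"
    unfolding lambda_max_def by (intro Greatest_equality)
  with l show ?thesis by simp
qed

lemma eigenvalue_uminus: "eigenvalue (- M) l \<longleftrightarrow> eigenvalue M (- l)"
proof -
  have "- M *v v = l *\<^sub>R v \<longleftrightarrow> M *v v = - l *\<^sub>R v" for v
    by (metis uminus_matrix_mult_vec minus_equation_iff scaleR_minus_left)
  then show ?thesis by (simp add: eigenvalue_def)
qed

text \<open>Negation exchanges the two ends of the spectrum, so the result on the maximum is applied
  to \<open>- M\<close>.\<close>

lemma lambda_min_properties:
  assumes "symmetric_matrix M"
  shows eigenvalue_lambda_min: "eigenvalue M (lambda_min M)"
    and lambda_min_le_rayleigh: "lambda_min M * (x \<bullet> x) \<le> x \<bullet> (M *v x)"
proof -
  have "symmetric_matrix (- M)"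
    using assms by (simp add: symmetric_matrix_def transpose_def vec_eq_iff)
  then obtain k where "eigenvalue (- M) k" "\<And>x. x \<bullet> (- M *v x) \<le> k * (x \<bullet> x)"
    using symmetric_matrix_max_eigenvalue by blast
  then obtain l where l: "eigenvalue M l" "\<And>x. l * (x \<bullet> x) \<le> x \<bullet> (M *v x)"
    using that[of "- k"] by (simp add: uminus_matrix_mult_vec eigenvalue_uminus minus_le_iff)
  have "l \<le> k" if "eigenvalue M k" for k
    using that
  proof (rule eigenvalue_rayleigh)
    fix v assume "0 < v \<bullet> v" "v \<bullet> (M *v v) = k * (v \<bullet> v)"
    then show ?thesis using l(2)[of v] by (simp add: mult_le_cancel_right_pos)
  qed
  with l have "lambda_min M = l"
    unfolding lambda_min_def by (intro Least_equality)
  with l show "eigenvalue M (lambda_min M)" "lambda_min M * (x \<bullet> x) \<le> x \<bullet> (M *v x)" by auto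
qed

text \<open>The last three bounds are the spectral estimates needed for the inverse, stated without
  it: with y the inverse of M applied to x, M y becomes x and y.(M y) becomes the Lyapunov function
  at x.\<close>

lemma pos_def_lambda_bounds:
  assumes "pos_def M"
  shows lambda_min_pos: "0 < lambda_min M"
    and lambda_min_le_max: "lambda_min M \<le> lambda_max M"
    and norm_mult_le_lambda_max_form: "(M *v y) \<bullet> (M *v y) \<le> lambda_max M * (y \<bullet> (M *v y))"
    and norm_mult_le_lambda_max: "(M *v y) \<bullet> (M *v y) \<le> (lambda_max M)\<^sup>2 * (y \<bullet> y)"
    and form_le_norm_mult: "lambda_min M * (y \<bullet> (M *v y)) \<le> (M *v y) \<bullet> (M *v y)"
proof -
  have sym: "symmetric_matrix M" using assms by (simp add: pos_def_def)
  note eig = eigenvalue_lambda_min[OF sym]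
  note ub = rayleigh_le_lambda_max[OF sym] and lb = lambda_min_le_rayleigh[OF sym]
  obtain v where v: "0 < v \<bullet> v" "v \<bullet> (M *v v) = lambda_min M * (v \<bullet> v)"
    using eig by (rule eigenvalue_rayleigh)
  have "0 < v \<bullet> (M *v v)" using v(1) assms by (auto simp: pos_def_def)
  then show pos: "0 < lambda_min M" using v by (simp add: zero_less_mult_iff)
  show le: "lambda_min M \<le> lambda_max M"
    using ub[of v] v by (simp add: mult_le_cancel_right_pos)
  define l L where "l = lambda_min M" and "L = lambda_max M"
  have lL: "0 < l" "0 < L" using pos le by (auto simp: l_def L_def)
  define a where "a = (M *v y) \<bullet> (M *v y)"
  define b where "b = y \<bullet> (M *v y)"
  \<comment> \<open>The form of M at y - M y / L is nonnegative. Its cubic term (M y).(M (M y)) is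
    at most L a, and what remains is b - a / L.\<close>
  have "0 \<le> (y - (1/L) *\<^sub>R (M *v y)) \<bullet> (M *v (y - (1/L) *\<^sub>R (M *v y)))"
    using lb pos by (meson inner_ge_zero less_imp_le mult_nonneg_nonneg order_trans)
  also have "\<dots> = b - 2 / L * a + (1/L)\<^sup>2 * ((M *v y) \<bullet> (M *v (M *v y)))"
    using symmetric_matrix_inner[OF sym, of y "M *v y"]
    by (simp add: matrix_vector_mult_diff_distrib matrix_vector_mult_scaleR inner_diff_left
        inner_diff_right a_def b_def power2_eq_square algebra_simps)
  also have "\<dots> \<le> b - 2 / L * a + (1/L)\<^sup>2 * (L * a)"
    using ub[of "M *v y"] by (intro add_left_mono mult_left_mono) (auto simp: L_def a_def)
  also have "\<dots> = b - a / L" using lL by (simp add: power2_eq_square field_simps)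
  finally show 1: "a \<le> lambda_max M * b"
    using lL by (simp add: field_simps flip: L_def)
  have "a \<le> L * (L * (y \<bullet> y))"
    using 1 ub[of y] lL unfolding L_def b_def by (meson mult_left_mono less_imp_le order_trans)
  then show "a \<le> (lambda_max M)\<^sup>2 * (y \<bullet> y)"
    by (simp add: power2_eq_square L_def mult.assoc)
  \<comment> \<open>Expanding |M y - l y|^2 and bounding l |y|^2 by b leaves a - l b.\<close>
  have "0 \<le> (M *v y - l *\<^sub>R y) \<bullet> (M *v y - l *\<^sub>R y)" by simp
  also have "\<dots> = a - 2 * l * b + l * (l * (y \<bullet> y))"
    by (simp add: inner_diff_left inner_diff_right a_def b_def inner_commute algebra_simps)
  also have "\<dots> \<le> a - 2 * l * b + l * b"
    using lb[of y] lL by (simp add: b_def l_def)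
  finally show "lambda_min M * b \<le> a" by (simp add: l_def mult.commute)
qed

lemma pos_def_matrix_inv:
  assumes "pos_def M"
  shows "M ** matrix_inv M = mat 1" "matrix_inv M ** M = mat 1"
proof -
  have "M *v x = 0 \<Longrightarrow> x = 0" for x
    using assms by (metis pos_def_def inner_zero_right less_irrefl)
  then have "invertible M"
    by (metis invertible_left_inverse matrix_left_invertible_ker)
  then show "M ** matrix_inv M = mat 1" "matrix_inv M ** M = mat 1"
    by (auto simp: invertible_def matrix_inv_def intro: someI2_ex)
qed

section \<open>From the vertices to every point of the ball\<close>

lemma min_on_le_max_on:
  fixes f :: "'a::topological_space \<Rightarrow> real"
  assumes "compact S" "continuous_on S f" "x \<in> S"
  shows "min_on S f \<le> f x" "f x \<le> max_on S f"
proof -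
  have c: "compact (f ` S)" "f ` S \<noteq> {}" using assms by (auto intro: compact_continuous_image)
  \<comment> \<open>Attainment is what gives \<open>LEAST\<close> and \<open>GREATEST\<close> their
    intended values.\<close>
  obtain a b where "a \<in> f ` S" "\<And>y. y \<in> f ` S \<Longrightarrow> a \<le> y" "b \<in> f ` S" "\<And>y. y \<in> f ` S \<Longrightarrow> y \<le> b"
    using compact_attains_inf[OF c] compact_attains_sup[OF c] by blast
  then have "min_on S f = a" "max_on S f = b"
    unfolding min_on_def max_on_def by (auto intro: Least_equality Greatest_equality)
  with \<open>\<And>y. y \<in> f ` S \<Longrightarrow> a \<le> y\<close> \<open>\<And>y. y \<in> f ` S \<Longrightarrow> y \<le> b\<close> assms(3)
  show "min_on S f \<le> f x" "f x \<le> max_on S f" by auto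
qed

text \<open>A maximiser of the linear function M |-> p.(M w) over the box between \<open>lo\<close>
  and \<open>hi\<close>, in which the entry (i, j) has the coefficient p_i w_j.\<close>

definition sign_vertex :: "real^'k^'n \<Rightarrow> real^'k^'n \<Rightarrow> real^'n \<Rightarrow> real^'k \<Rightarrow> real^'k^'n" where
  "sign_vertex lo hi p w = (\<chi> i j. if 0 \<le> p $ i * w $ j then hi $ i $ j else lo $ i $ j)"

lemma inner_mult_le_sign_vertex:
  assumes "\<And>i j. lo $ i $ j \<le> M $ i $ j" "\<And>i j. M $ i $ j \<le> hi $ i $ j"
  shows "p \<bullet> (M *v w) \<le> p \<bullet> (sign_vertex lo hi p w *v w)"
proof -
  have form: "p \<bullet> (N *v w) = (\<Sum>i\<in>UNIV. \<Sum>j\<in>UNIV. N $ i $ j * (p $ i * w $ j))" for N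
    by (simp add: inner_vec_def matrix_vector_mult_def sum_distrib_left mult_ac)
  show ?thesis
    unfolding form sign_vertex_def
    using assms by (intro sum_mono) (auto intro: mult_right_mono mult_right_mono_neg)
qed

text \<open>The vertex may be chosen after p and q, because the matrix inequality is tested on a
  single vector. Hence [A x, B x] need not be written as a convex combination of vertices.\<close>

lemma lmi_at_point:
  fixes A :: "real^'n \<Rightarrow> real^'n^'n" and B :: "real^'n \<Rightarrow> real^'m^'n"
  assumes cA: "\<And>i j. continuous_on (cball 0 r) (\<lambda>x. A x $ i $ j)"
    and cB: "\<And>i j. continuous_on (cball 0 r) (\<lambda>x. B x $ i $ j)"
    and sym: "symmetric_matrix \<Gamma>"
    and lmi: "\<forall>G \<in> vertex_set r A B.
           block22 (- \<Gamma>) (G ** vcat \<Gamma> Y)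
                   (hcat \<Gamma> (transpose Y) ** transpose G) (- \<Gamma> + \<epsilon> *\<^sub>R mat 1) \<preceq> 0"
    and x: "x \<in> cball 0 r"
  shows "2 * (p \<bullet> (A x *v (\<Gamma> *v q) + B x *v (Y *v q))) + \<epsilon> * (q \<bullet> q)
    \<le> p \<bullet> (\<Gamma> *v p) + q \<bullet> (\<Gamma> *v q)"
proof -
  let ?lo = "\<lambda>M. \<chi> i j. min_on (cball 0 r) (\<lambda>x. M x $ i $ j)"
  let ?hi = "\<lambda>M. \<chi> i j. max_on (cball 0 r) (\<lambda>x. M x $ i $ j)"
  \<comment> \<open>Applied to q, the off-diagonal block gives \<alpha> (\<Gamma> q) + \<beta> (Y
    q). The two halves of the vertex therefore use different right vectors but the same p.\<close>
  define \<alpha> where "\<alpha> = sign_vertex (?lo A) (?hi A) p (\<Gamma> *v q)"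
  define \<beta> where "\<beta> = sign_vertex (?lo B) (?hi B) p (Y *v q)"
  define G where "G = hcat \<alpha> \<beta>"
  have "G \<in> vertex_set r A B"
    unfolding vertex_set_def G_def \<alpha>_def \<beta>_def
    by (intro CollectI exI conjI) (auto simp: sign_vertex_def)
  then have "block22 (- \<Gamma>) (G ** vcat \<Gamma> Y)
      (hcat \<Gamma> (transpose Y) ** transpose G) (- \<Gamma> + \<epsilon> *\<^sub>R mat 1) \<preceq> 0" (is "?L \<preceq> 0")
    using lmi by blast
  then have "0 \<le> vjoin p q \<bullet> ((0 - ?L) *v vjoin p q)"
    by (simp add: loewner_le_def pos_semidef_def)
  then have "vjoin p q \<bullet> (?L *v vjoin p q) \<le> 0"
    by (simp only: diff_0 uminus_matrix_mult_vec inner_minus_right neg_0_le_iff_le)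
  \<comment> \<open>Symmetry of \<Gamma> makes the off-diagonal blocks transposes of each other, so
    they contribute equally; this is the factor 2.\<close>
  moreover have "hcat \<Gamma> (transpose Y) ** transpose G = transpose (G ** vcat \<Gamma> Y)"
  proof -
    have "hcat \<Gamma> (transpose Y) = transpose (vcat \<Gamma> Y)"
      using sym unfolding symmetric_matrix_def
      by (subst (1) sym[unfolded symmetric_matrix_def, symmetric])
        (simp add: vec_eq_iff hcat_def vcat_def transpose_def split: sum.split)
    then show ?thesis by (simp add: matrix_transpose_mul)
  qed
  moreover have "q \<bullet> (transpose N *v p) = p \<bullet> (N *v q)" for N :: "real^'n^'n"
    by (metis dot_lmul_matrix inner_commute transpose_matrix_vector)
  moreover have "(- \<Gamma> + \<epsilon> *\<^sub>R mat 1) *v q = - (\<Gamma> *v q) + \<epsilon> *\<^sub>R q"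
    by (simp only: matrix_vector_mult_add_rdistrib uminus_matrix_mult_vec
        scaleR_matrix_vector_assoc[symmetric] matrix_vector_mul_lid)
  moreover have "(G ** vcat \<Gamma> Y) *v q = \<alpha> *v (\<Gamma> *v q) + \<beta> *v (Y *v q)"
    by (simp add: G_def vcat_mult_vec hcat_mult_vjoin flip: matrix_vector_mul_assoc)
  ultimately have vertex: "2 * (p \<bullet> (\<alpha> *v (\<Gamma> *v q) + \<beta> *v (Y *v q))) + \<epsilon> * (q \<bullet> q)
      \<le> p \<bullet> (\<Gamma> *v p) + q \<bullet> (\<Gamma> *v q)"
    by (simp add: block22_quadratic_form uminus_matrix_mult_vec inner_add_right inner_diff_right)
  have "p \<bullet> (A x *v (\<Gamma> *v q)) \<le> p \<bullet> (\<alpha> *v (\<Gamma> *v q))"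
    unfolding \<alpha>_def using min_on_le_max_on[OF compact_cball cA x]
    by (intro inner_mult_le_sign_vertex) auto
  moreover have "p \<bullet> (B x *v (Y *v q)) \<le> p \<bullet> (\<beta> *v (Y *v q))"
    unfolding \<beta>_def using min_on_le_max_on[OF compact_cball cB x]
    by (intro inner_mult_le_sign_vertex) auto
  ultimately show ?thesis using vertex by (simp add: inner_add_right)
qed

section \<open>Contraction and invariance for the closed loop\<close>

theorem theorem1:
  fixes X :: "(real^'n) set"
    and A :: "real^'n \<Rightarrow> real^'n^'n"
    and B :: "real^'n \<Rightarrow> real^'m^'n"
    and r \<epsilon> r0 :: real
    and \<Gamma> :: "real^'n^'n"
    and Y K :: "real^'n^'m"
  assumes "0 \<in> X"
    and "\<And>i j. continuous_on X (\<lambda>x. A x $ i $ j)"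
    and "\<And>i j. continuous_on X (\<lambda>x. B x $ i $ j)"
    and "r > 0" and "cball 0 r \<subseteq> X"
    and "symmetric_matrix \<Gamma>" and "0 \<prec> \<Gamma>" and "\<epsilon> > 0"
    and "\<forall>G \<in> vertex_set r A B.
           block22 (- \<Gamma>) (G ** vcat \<Gamma> Y)
                   (hcat \<Gamma> (transpose Y) ** transpose G) (- \<Gamma> + \<epsilon> *\<^sub>R mat 1) \<preceq> 0"
    and "K = Y ** matrix_inv \<Gamma>"
    and "r0 = (if (lambda_max \<Gamma>)\<^sup>2 - \<epsilon> * lambda_min \<Gamma> = 0 then r
               else min r (sqrt (lambda_max \<Gamma> * lambda_min \<Gamma> /
                                 ((lambda_max \<Gamma>)\<^sup>2 - \<epsilon> * lambda_min \<Gamma>)) * r))"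
  shows "region_of_attraction X (\<lambda>x. (A x + B x ** K) *v x) (cball 0 r0) \<and>
         exponentially_convergent_from X (\<lambda>x. (A x + B x ** K) *v x) (cball 0 r0)"
proof -
  define P where "P = matrix_inv \<Gamma>"
  define f where "f = (\<lambda>x. (A x + B x ** K) *v x)"
  define V where "V = (\<lambda>x. x \<bullet> (P *v x))"
  define l L where "l = lambda_min \<Gamma>" and "L = lambda_max \<Gamma>"
  \<comment> \<open>The contraction factor of \<open>V\<close>. The denominator in \<open>r0\<close>
    is L^2 \<sigma>, so the quotient read as infinite is exactly the case \<sigma> = 0.\<close>
  define \<sigma> where "\<sigma> = 1 - \<epsilon> * l / L\<^sup>2"
  have pd: "pos_def \<Gamma>" using assms(7) by (simp add: loewner_less_def)
  have \<Gamma>P: "\<Gamma> *v (P *v x) = x" for x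
    using pos_def_matrix_inv[OF pd] by (simp add: P_def matrix_vector_mul_assoc)
  have l: "0 < l" "l \<le> L" using lambda_min_pos[OF pd] lambda_min_le_max[OF pd] by (auto simp: l_def L_def)
  then have L: "0 < L" by simp
  have V1: "x \<bullet> x \<le> L * V x" and P_ge: "x \<bullet> x \<le> L\<^sup>2 * ((P *v x) \<bullet> (P *v x))"
    and V2: "l * V x \<le> x \<bullet> x" for x
    using norm_mult_le_lambda_max_form[OF pd, of "P *v x"] norm_mult_le_lambda_max[OF pd, of "P *v x"]
      form_le_norm_mult[OF pd, of "P *v x"]
    by (simp_all add: \<Gamma>P V_def l_def L_def inner_commute)
  have V0: "0 \<le> V x" for x
    using V1[of x] L by (meson inner_ge_zero order_trans zero_le_mult_iff not_le less_le_trans less_imp_le)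
  have contA: "continuous_on (cball 0 r) (\<lambda>x. A x $ i $ j)"
    and contB: "continuous_on (cball 0 r) (\<lambda>x. B x $ i $ j')" for i j j'
    by (rule continuous_on_subset[OF assms(2) assms(5)] continuous_on_subset[OF assms(3) assms(5)])+
  note lmi = lmi_at_point[OF contA contB assms(6,9)]

  \<comment> \<open>At x = 0 and p = 0 only the lower right block is tested. An eigenvector for l
    then yields \<epsilon> \<le> l, and l \<le> L does the rest.\<close>
  have "0 \<le> \<sigma>"
  proof -
    obtain v where v: "0 < v \<bullet> v" "v \<bullet> (\<Gamma> *v v) = l * (v \<bullet> v)"
      using eigenvalue_lambda_min[OF assms(6)] unfolding l_def by (rule eigenvalue_rayleigh)
    have "\<epsilon> * (v \<bullet> v) \<le> l * (v \<bullet> v)"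
      using lmi[of 0 0 v] v assms(4) by simp
    then have "\<epsilon> \<le> l" using v by simp
    then have "\<epsilon> * l \<le> L * L" using l assms(8) by (intro mult_mono) auto
    then show ?thesis using L by (simp add: \<sigma>_def power2_eq_square)
  qed
  have "\<sigma> < 1" using assms(8) l L by (simp add: \<sigma>_def)

  have decr: "V (f x) \<le> V x - \<epsilon> * ((P *v x) \<bullet> (P *v x))" if "norm x \<le> r" for x
  proof -
    have "f x = A x *v (\<Gamma> *v (P *v x)) + B x *v (Y *v (P *v x))"
      by (simp add: f_def assms(10) \<Gamma>P matrix_vector_mult_add_rdistrib flip: P_def matrix_vector_mul_assoc)
    moreover have "(P *v f x) \<bullet> f x = V (f x)" "(P *v x) \<bullet> x = V x"
      by (simp_all add: V_def inner_commute)
    \<comment> \<open>For p = P (f x) and q = P x the inequality reads 2 V (f x) + \<epsilon> |P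
      x|^2 \<le> V (f x) + V x.\<close>
    ultimately show ?thesis
      using lmi[of x "P *v f x" "P *v x"] that by (simp add: \<Gamma>P)
  qed
  have decr': "V (f x) \<le> V x - \<epsilon> * (x \<bullet> x) / L\<^sup>2" if "norm x \<le> r" for x
  proof -
    have "\<epsilon> * (x \<bullet> x) / L\<^sup>2 \<le> \<epsilon> * ((P *v x) \<bullet> (P *v x))"
      using P_ge[of x] assms(8) L by (simp add: field_simps)
    then show ?thesis using decr[OF that] by simp
  qed
  have contr: "V (f x) \<le> \<sigma> * V x" if "norm x \<le> r" for x
  proof -
    have "\<epsilon> * (l * V x) / L\<^sup>2 \<le> \<epsilon> * (x \<bullet> x) / L\<^sup>2"
      using V2[of x] assms(8) by (intro divide_right_mono mult_left_mono) auto
    then show ?thesis using decr'[OF that] by (simp add: \<sigma>_def algebra_simps)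
  qed
  have sublevel: "norm x \<le> r" if "L * V x \<le> r\<^sup>2" for x
  proof -
    have "(norm x)\<^sup>2 \<le> r\<^sup>2" using V1[of x] that by (simp add: power2_norm_eq_inner)
    then show ?thesis using assms(4) by (simp add: power2_le_iff_abs_le)
  qed
  have "r0 \<le> r" using assms(11) by (auto split: if_splits)
  \<comment> \<open>The point x itself may lie outside the sublevel set. Its image satisfies L V (f
    x) \<le> (L \<sigma> / l) |x|^2, and for \<sigma> > 0 the second entry of the minimum in
    \<open>r0\<close> is the radius at which this bound equals r^2.\<close>
  have first: "L * V (f x) \<le> r\<^sup>2" if x: "norm x \<le> r0" for x
  proof -
    have D: "L\<^sup>2 - \<epsilon> * l = L\<^sup>2 * \<sigma>" using L by (simp add: \<sigma>_def field_simps)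
    have "l * V (f x) \<le> \<sigma> * (x \<bullet> x)"
    proof -
      have "l * V (f x) \<le> l * (V x - \<epsilon> * (x \<bullet> x) / L\<^sup>2)"
        using decr'[of x] x \<open>r0 \<le> r\<close> l by (intro mult_left_mono) auto
      also have "\<dots> \<le> \<sigma> * (x \<bullet> x)" using V2[of x] by (simp add: \<sigma>_def algebra_simps)
      finally show ?thesis .
    qed
    then have *: "L * (l * V (f x)) \<le> L * (\<sigma> * (norm x)\<^sup>2)"
      using L by (simp add: power2_norm_eq_inner)
    have "L * \<sigma> * (norm x)\<^sup>2 \<le> l * r\<^sup>2"
    proof (cases "\<sigma> = 0")
      case True
      then show ?thesis using l by simp
    next
      case False
      then have s: "0 < \<sigma>" using \<open>0 \<le> \<sigma>\<close> by simp
      then have "norm x \<le> sqrt (L * l / (L\<^sup>2 * \<sigma>)) * r"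
        using x assms(11) D L by (auto simp flip: l_def L_def split: if_splits)
      then have "(norm x)\<^sup>2 \<le> (sqrt (L * l / (L\<^sup>2 * \<sigma>)) * r)\<^sup>2"
        by (intro power_mono) auto
      also have "\<dots> = L * l / (L\<^sup>2 * \<sigma>) * r\<^sup>2"
        using L l s by (simp add: power_mult_distrib)
      finally show ?thesis using L s by (simp add: field_simps power2_eq_square)
    qed
    with * have "l * (L * V (f x)) \<le> l * r\<^sup>2" by (simp add: mult_ac)
    then show ?thesis using l by simp
  qed
  \<comment> \<open>The sublevel bound is claimed only for k > 0, since it may fail at the start.
    From then on it persists because \<open>V\<close> does not increase, and it keeps the orbit in
    the ball where \<open>contr\<close> applies.\<close>
  have orbit: "norm ((f ^^ k) x) \<le> r \<and> V ((f ^^ k) x) \<le> \<sigma> ^ k * V x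
      \<and> (0 < k \<longrightarrow> L * V ((f ^^ k) x) \<le> r\<^sup>2)" if x: "norm x \<le> r0" for x k
  proof (induction k)
    case 0
    then show ?case using x \<open>r0 \<le> r\<close> by simp
  next
    case (Suc k)
    let ?y = "(f ^^ k) x"
    have step: "V (f ?y) \<le> \<sigma> * V ?y" using contr Suc by blast
    also have "\<dots> \<le> \<sigma> * (\<sigma> ^ k * V x)" using Suc \<open>0 \<le> \<sigma>\<close> by (intro mult_left_mono) auto
    finally have "V ((f ^^ Suc k) x) \<le> \<sigma> ^ Suc k * V x" by simp
    moreover have "L * V ((f ^^ Suc k) x) \<le> r\<^sup>2"
    proof (cases "k = 0")
      case True
      then show ?thesis using first[OF x] by simp
    next
      case False
      have "V (f ?y) \<le> V ?y"
        using step mult_right_mono[of \<sigma> 1 "V ?y"] V0[of ?y] \<open>\<sigma> < 1\<close> by simp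
      then have "L * V (f ?y) \<le> L * V ?y" using L by simp
      then show ?thesis using False Suc by simp
    qed
    ultimately show ?case using sublevel by blast
  qed

  \<comment> \<open>\<open>\<sigma> = 0\<close> is possible, but the rate has to be positive.\<close>
  define \<rho> where "\<rho> = sqrt (max \<sigma> (1/2))"
  \<comment> \<open>Norms and \<open>V\<close> are compared twice, by |x(k)|^2 \<le> L V (x(k)) and
    V (x(0)) \<le> |x(0)|^2 / l. This costs the factor L / l for squared norms, hence the
    root.\<close>
  define c where "c = sqrt (L / l)"
  have \<rho>: "0 < \<rho>" "\<rho> < 1" using \<open>\<sigma> < 1\<close> by (auto simp: \<rho>_def)
  have "0 < c" using l L by (simp add: c_def)
  have decay: "norm ((f ^^ k) x) \<le> c * \<rho> ^ k * norm x" if x: "norm x \<le> r0" for x k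
  proof (rule power2_le_imp_le)
    have \<rho>2: "(\<rho> ^ k)\<^sup>2 = max \<sigma> (1/2) ^ k"
      by (simp add: \<rho>_def power2_eq_square real_sqrt_power flip: power_mult_distrib)
    have "V ((f ^^ k) x) \<le> \<sigma> ^ k * V x" using orbit[OF x] by blast
    also have "\<dots> \<le> (\<rho> ^ k)\<^sup>2 * V x"
      using V0 \<open>0 \<le> \<sigma>\<close> unfolding \<rho>2 by (intro mult_right_mono power_mono) auto
    also have "\<dots> \<le> (\<rho> ^ k)\<^sup>2 * ((x \<bullet> x) / l)"
      using V2[of x] l by (intro mult_left_mono) (auto simp: field_simps)
    finally have "L * V ((f ^^ k) x) \<le> L * ((\<rho> ^ k)\<^sup>2 * ((x \<bullet> x) / l))"
      using L by (intro mult_left_mono) auto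
    then have "(norm ((f ^^ k) x))\<^sup>2 \<le> L * ((\<rho> ^ k)\<^sup>2 * ((x \<bullet> x) / l))"
      using V1[of "(f ^^ k) x"] by (simp add: power2_norm_eq_inner)
    also have "\<dots> = (c * \<rho> ^ k * norm x)\<^sup>2"
      using l L by (simp add: c_def power_mult_distrib power2_norm_eq_inner)
    finally show "(norm ((f ^^ k) x))\<^sup>2 \<le> (c * \<rho> ^ k * norm x)\<^sup>2" .
    show "0 \<le> c * \<rho> ^ k * norm x" using \<open>0 < c\<close> \<rho> by simp
  qed
  have stays: "(f ^^ k) x \<in> X" if "norm x \<le> r0" for x k
    using orbit[OF that] assms(5) by (auto simp: subset_iff)
  have limit: "(\<lambda>k. (f ^^ k) x) \<longlonglongrightarrow> 0" if x: "norm x \<le> r0" for x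
  proof (rule Lim_null_comparison)
    have "(\<lambda>k. c * \<rho> ^ k * norm x) \<longlonglongrightarrow> c * 0 * norm x"
      using \<rho> by (intro tendsto_intros LIMSEQ_realpow_zero) auto
    then show "(\<lambda>k. c * \<rho> ^ k * norm x) \<longlonglongrightarrow> 0" by simp
  qed (use decay[OF x] in auto)
  have "f 0 = 0" by (simp add: f_def)
  have "region_of_attraction X f (cball 0 r0)"
    using assms(1) \<open>f 0 = 0\<close> stays limit by (auto simp: region_of_attraction_def)
  moreover have "exponentially_convergent_from X f (cball 0 r0)"
    unfolding exponentially_convergent_from_def
    using stays decay \<open>0 < c\<close> \<rho> by (intro conjI exI[of _ c] exI[of _ \<rho>]) auto
  ultimately show ?thesis by (simp add: f_def)
qed

end
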